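(* Let $\mathcal{M}$ be one of the four surfaces $\mathcal{S}$ (unit sphere), $\mathcal{Y}$ (unit cylinder), $\mathcal{C}$ (unit cone), $\mathcal{E}$ (ellipsoid) in $\mathbb{R}^3$. Let $G=(V,E)$ be a finite graph with $n=|V|\geq 4$, and let $(G,p)$ be a framework on $\mathcal{M}$ which is generic and globally rigid on $\mathcal{M}$. Then $G$ is $k$-connected, where $k=3$ if $\mathcal{M}=\mathcal{S}$, $k=2$ if $\mathcal{M}\in\{\mathcal{Y},\mathcal{C}\}$, and $k=1$ if $\mathcal{M}=\mathcal{E}$.
   Context: Surfaces: $\mathcal{S}=\{x^2+y^2+z^2=1\}$; $\mathcal{Y}=\{x^2+y^2=1\}$; $\mathcal{C}=\{x^2+y^2=z^2\}$; $\mathcal{E}=\{x^2+ay^2+bz^2=1\}$ for some fixed $a,b\in\mathbb{Q}$ with $1<a<b$; all are subsets of $\mathbb{R}^3$. Graphs are finite and simple. A framework $(G,p)$ on $\mathcal{M}$ is a finite graph $G=(V,E)$ together with a map $p:V\to\mathcal{M}$. Two frameworks $(G,p)$, $(G,q)$ are equivalent if $\|p(u)-p(v)\|=\|q(u)-q(v)\|$ for all $uv\in E$, and congruent if $\|p(u)-p(v)\|=\|q(u)-q(v)\|$ for all pairs $u,v\in V$. $(G,p)$ is globally rigid on $\mathcal{M}$ if every framework $(G,q)$ on $\mathcal{M}$ which is equivalent to $(G,p)$ is congruent to $(G,p)$. $(G,p)$ is generic on $\mathcal{M}$ if the field $\mathbb{Q}(p)$ generated over $\mathbb{Q}$ by all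 coordinates of the points $p(v)$, $v\in V$, has transcendence degree $2|V|$ over $\mathbb{Q}$. $k$-connected means $k$-vertex-connected: $|V|\ge k+1$ and deleting any set of fewer than $k$ vertices leaves a connected graph. *)

theory Defs
  imports
    "HOL-Analysis.Analysis"
    "HOL-Library.Poly_Mapping"
    "Graph_Theory.Graph_Theory"
begin

section \<open>The surfaces\<close>

definition unit_sphere :: "(real ^ 3) set" where
  "unit_sphere = {x. (x $ 1)\<^sup>2 + (x $ 2)\<^sup>2 + (x $ 3)\<^sup>2 = 1}"

definition unit_cylinder :: "(real ^ 3) set" where
  "unit_cylinder = {x. (x $ 1)\<^sup>2 + (x $ 2)\<^sup>2 = 1}"

definition unit_cone :: "(real ^ 3) set" where
  "unit_cone = {x. (x $ 1)\<^sup>2 + (x $ 2)\<^sup>2 = (x $ 3)\<^sup>2}"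

definition ellipsoid :: "rat \<Rightarrow> rat \<Rightarrow> (real ^ 3) set" where
  "ellipsoid a b = {x. (x $ 1)\<^sup>2 + of_rat a * (x $ 2)\<^sup>2 + of_rat b * (x $ 3)\<^sup>2 = 1}"


section \<open>Graphs and vertex connectivity\<close>

text \<open>
  A finite simple graph is a \<^term>\<open>pair_graph\<close>: finite and loop-free, with an edge \<open>uv\<close> represented
  by the two arcs \<open>(u, v)\<close> and \<open>(v, u)\<close>. The name \<open>connected\<close> is qualified because the topological
  notion has the same name.
\<close>

definition k_connected :: "nat \<Rightarrow> 'v pair_pre_digraph \<Rightarrow> bool" where
  "k_connected k G \<longleftrightarrow>
     k + 1 \<le> card (pverts G) \<and>
     (\<forall>S \<subseteq> pverts G. card S < k \<longrightarrow>
        Digraph_Component.connected (with_proj G \<restriction> (pverts G - S)))"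


section \<open>Frameworks on a surface\<close>

text \<open>
  A placement is a function on the whole vertex type; only its values on the vertex set matter.
\<close>

definition framework_on ::
  "(real ^ 3) set \<Rightarrow> 'v pair_pre_digraph \<Rightarrow> ('v \<Rightarrow> real ^ 3) \<Rightarrow> bool" where
  "framework_on M G p \<longleftrightarrow> (\<forall>v \<in> pverts G. p v \<in> M)"

definition equivalent_frameworks ::
  "'v pair_pre_digraph \<Rightarrow> ('v \<Rightarrow> real ^ 3) \<Rightarrow> ('v \<Rightarrow> real ^ 3) \<Rightarrow> bool" where
  "equivalent_frameworks G p q \<longleftrightarrow>
     (\<forall>(u, v) \<in> parcs G. norm (p u - p v) = norm (q u - q v))"

definition congruent_frameworks ::
  "'v pair_pre_digraph \<Rightarrow> ('v \<Rightarrow> real ^ 3) \<Rightarrow> ('v \<Rightarrow> real ^ 3) \<Rightarrow> bool" where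
  "congruent_frameworks G p q \<longleftrightarrow>
     (\<forall>u \<in> pverts G. \<forall>v \<in> pverts G. norm (p u - p v) = norm (q u - q v))"

definition globally_rigid_on ::
  "(real ^ 3) set \<Rightarrow> 'v pair_pre_digraph \<Rightarrow> ('v \<Rightarrow> real ^ 3) \<Rightarrow> bool" where
  "globally_rigid_on M G p \<longleftrightarrow>
     (\<forall>q. framework_on M G q \<longrightarrow> equivalent_frameworks G p q \<longrightarrow> congruent_frameworks G p q)"


section \<open>Transcendence degree over the rationals and genericity\<close>

definition real_subfield :: "real set \<Rightarrow> bool" where
  "real_subfield K \<longleftrightarrow>
     0 \<in> K \<and> 1 \<in> K \<and>
     (\<forall>x \<in> K. \<forall>y \<in> K. x + y \<in> K \<and> x * y \<in> K) \<and>
     (\<forall>x \<in> K. - x \<in> K \<and> inverse x \<in> K)"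

text \<open>
  Every subfield of the reals contains the rationals, so the smallest subfield containing \<open>S\<close>
  is the field generated by \<open>S\<close> over the rationals.
\<close>

definition rat_adjoin :: "real set \<Rightarrow> real set" where
  "rat_adjoin S = real_subfield hull S"

text \<open>
  Rational polynomials in indeterminates \<open>X\<^sub>b\<close> indexed by real numbers \<open>b\<close>, as finitely supported
  maps from monomials (finitely supported exponent maps) to coefficients.
  \<open>self_eval P\<close> is the value of \<open>P\<close> under \<open>X\<^sub>b \<mapsto> b\<close>.
\<close>

definition self_eval :: "((real \<Rightarrow>\<^sub>0 nat) \<Rightarrow>\<^sub>0 rat) \<Rightarrow> real" where
  "self_eval P =
     (\<Sum>m \<in> Poly_Mapping.keys P. of_rat (Poly_Mapping.lookup P m) *
        (\<Prod>b \<in> Poly_Mapping.keys m. b ^ Poly_Mapping.lookup m b))"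

definition alg_independent :: "real set \<Rightarrow> bool" where
  "alg_independent B \<longleftrightarrow>
     (\<forall>P. (\<forall>m \<in> Poly_Mapping.keys P. Poly_Mapping.keys m \<subseteq> B) \<longrightarrow> self_eval P = 0 \<longrightarrow> P = 0)"

definition transcendence_basis :: "real set \<Rightarrow> real set \<Rightarrow> bool" where
  "transcendence_basis K B \<longleftrightarrow>
     B \<subseteq> K \<and> alg_independent B \<and>
     (\<forall>C. B \<subseteq> C \<longrightarrow> C \<subseteq> K \<longrightarrow> alg_independent C \<longrightarrow> C = B)"

text \<open>
  A relation rather than a function, since \<open>card\<close> would assign degree 0 to a field with an
  infinite transcendence basis.
\<close>

definition has_transcendence_degree :: "real set \<Rightarrow> nat \<Rightarrow> bool" where
  "has_transcendence_degree K d \<longleftrightarrow> (\<exists>B. transcendence_basis K B \<and> finite B \<and> card B = d)"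

definition generic_framework :: "'v pair_pre_digraph \<Rightarrow> ('v \<Rightarrow> real ^ 3) \<Rightarrow> bool" where
  "generic_framework G p \<longleftrightarrow>
     has_transcendence_degree (rat_adjoin {p v $ i | v i. v \<in> pverts G}) (2 * card (pverts G))"

end

theory Submission
  imports Defs
begin

text \<open>
  Each of the four surfaces is symmetric under reflection in certain planes through the origin: all
  of them for the sphere, those containing the \<open>z\<close>-axis for the cylinder and the cone, and the
  coordinate plane \<open>x = 0\<close> for the ellipsoid. The normals of these planes form a linear space of
  dimension \<open>k = 3, 2, 2, 1\<close>, and this dimension is the connectivity bound. Suppose that
  removing a set \<open>S\<close> of fewer than \<open>k\<close> vertices disconnects the graph. Then \<open>S\<close> imposes fewer than \<open>k\<close>
  linear conditions on a normal, so some mirror plane contains all points of \<open>S\<close>. Reflecting only one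
  side of the separation changes no edge length, because every edge lies within one side together
  with \<open>S\<close>, and \<open>S\<close> is fixed. The distance between two points \<open>x\<close>, \<open>y\<close> on different sides does change
  unless one of them lies on the mirror, since the square of the distance changes by
  \<open>4 (c \<bullet> x) (c \<bullet> y) / (c \<bullet> c)\<close> for a normal \<open>c\<close>. This contradicts global rigidity
  (\<open>mirror_separator_impossible\<close>).

  Genericity keeps the other points off the mirror. The normal can be chosen with coordinates in the
  field generated by the points of \<open>S\<close> (\<open>normal_through_few_points\<close>). A point of the surface that
  lies on the mirror lies on a plane section of the surface, hence on a curve: its coordinates become
  algebraic after adjoining a single real number, whereas every other point needs at most two. All
  coordinates of the framework would then be algebraic over \<open>2 n - 1\<close> real numbers, which is
  incompatible with transcendence degree \<open>2 n\<close> (\<open>generic_off_mirror\<close>).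

  The algebra behind the last sentence is \<open>card_alg_independent_le\<close>: a finite algebraically
  independent set of numbers that are algebraic over \<open>T\<close> has at most \<open>card T\<close> elements. Instead of
  an exchange argument the proof compares growth rates. The monomials of degree at most \<open>N\<close> in each
  of \<open>d\<close> independent numbers span a space of dimension \<open>(N + 1) ^ d\<close> over \<open>\<rat>\<close>. After clearing
  denominators this space lies in a finitely generated module over \<open>\<rat>[T]\<close>, whose part of
  degree at most a multiple of \<open>N\<close> has dimension bounded by a constant times \<open>(N + 1) ^ card T\<close>.
  All equations that occur are quadratic, so being algebraic over \<open>T\<close> enters only through fields
  closed under square roots.
\<close>

section \<open>Linear independence over the rationals\<close>

interpretation rat_vs: vector_space "\<lambda>(q::rat) (x::real). of_rat q * x"
  by unfold_locales (simp_all add: algebra_simps of_rat_add of_rat_mult)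

lemma span_mult_right:
  assumes "x \<in> rat_vs.span X" and "(\<lambda>a. a * y) ` X \<subseteq> rat_vs.span Z"
  shows "x * y \<in> rat_vs.span Z"
  using assms(1)
proof (induction rule: rat_vs.span_induct_alt)
  case base
  show ?case by (simp add: rat_vs.span_zero)
next
  case (step c a b)
  have "of_rat c * (a * y) + b * y \<in> rat_vs.span Z"
    using step assms(2) by (intro rat_vs.span_add rat_vs.span_scale) auto
  then show ?case by (simp add: algebra_simps)
qed

lemma span_mult:
  assumes "x \<in> rat_vs.span X" and "y \<in> rat_vs.span Y"
    and "\<And>a b. a \<in> X \<Longrightarrow> b \<in> Y \<Longrightarrow> a * b \<in> rat_vs.span Z"
  shows "x * y \<in> rat_vs.span Z"
proof (rule span_mult_right[OF assms(1)], safe)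
  fix a assume "a \<in> X"
  then have "(\<lambda>b. b * a) ` Y \<subseteq> rat_vs.span Z"
    using assms(3)[of a] by (simp add: image_subset_iff mult.commute[of _ a])
  from span_mult_right[OF assms(2) this] show "a * y \<in> rat_vs.span Z"
    by (simp only: mult.commute[of a y])
qed

text \<open>
  Counting is done by families rather than sets, so that distinctness of the members \<open>x a\<close> is part of
  the conclusion drawn from independence.
\<close>
lemma card_le_of_independent_family:
  assumes A: "finite A" and S: "finite S" "x ` A \<subseteq> rat_vs.span S"
    and ind: "\<And>q. (\<Sum>a\<in>A. of_rat (q a) * x a) = 0 \<Longrightarrow> \<forall>a\<in>A. q a = 0"
  shows "card A \<le> card S"
proof -
  have inj: "inj_on x A"
  proof (rule inj_onI, rule ccontr)
    fix a b assume ab: "a \<in> A" "b \<in> A" "x a = x b" "a \<noteq> b"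
    define q :: "'a \<Rightarrow> rat" where "q c = (if c = a then 1 else if c = b then -1 else 0)" for c
    have "(\<Sum>c\<in>A. of_rat (q c) * x c) = (\<Sum>c\<in>{a, b}. of_rat (q c) * x c)"
      using ab A by (intro sum.mono_neutral_right) (auto simp: q_def)
    also have "\<dots> = 0"
      using ab by (simp add: q_def)
    finally have "q a = 0"
      using ind ab by blast
    then show False by (simp add: q_def)
  qed
  have "rat_vs.independent (x ` A)"
  proof (rule rat_vs.independent_if_scalars_zero)
    fix f v assume "(\<Sum>v\<in>x ` A. of_rat (f v) * v) = 0" and v: "v \<in> x ` A"
    then have "(\<Sum>a\<in>A. of_rat ((f \<circ> x) a) * x a) = 0"
      using inj by (simp add: sum.reindex)
    from ind[OF this] v show "f v = 0" by auto
  qed (use A in simp)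
  from rat_vs.independent_span_bound[OF S(1) this S(2)] show ?thesis
    by (simp add: card_image[OF inj])
qed

section \<open>Integral elements over a polynomial ring\<close>

text \<open>
  The degree is bounded in each variable separately; this makes the number of monomials a plain power.
\<close>
definition box_monomials :: "real set \<Rightarrow> nat \<Rightarrow> real set" where
  "box_monomials T D = (\<lambda>e. \<Prod>t\<in>T. t ^ e t) ` (T \<rightarrow>\<^sub>E {..D})"

text \<open>
  The filtration by degree of the \<open>\<rat>[T]\<close>-module generated by \<open>W\<close>.
\<close>
definition module_upto :: "real set \<Rightarrow> real set \<Rightarrow> nat \<Rightarrow> real set" where
  "module_upto T W D = rat_vs.span ((\<lambda>(m, w). m * w) ` (box_monomials T D \<times> W))"

definition stabilises :: "real set \<Rightarrow> real set \<Rightarrow> nat \<Rightarrow> real \<Rightarrow> bool" where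
  "stabilises T W D x \<longleftrightarrow> (\<forall>w\<in>W. x * w \<in> module_upto T W D)"

text \<open>
  Integrality over \<open>\<rat>[T]\<close> in its module form: multiplication by \<open>x\<close> maps a finitely generated
  \<open>\<rat>[T]\<close>-submodule of the reals containing 1 to itself. No polynomial equations appear, and the bound
  \<open>D\<close> records how far the degree rises.
\<close>
definition poly_integral :: "real set \<Rightarrow> real \<Rightarrow> bool" where
  "poly_integral T x \<longleftrightarrow> (\<exists>W D. finite W \<and> 1 \<in> W \<and> stabilises T W D x)"

lemma finite_box_monomials: "finite T \<Longrightarrow> finite (box_monomials T D)"
  unfolding box_monomials_def by (intro finite_imageI finite_PiE) auto

lemma card_box_monomials:
  assumes "finite T"
  shows "card (box_monomials T D) \<le> (D + 1) ^ card T"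
proof -
  have "card (box_monomials T D) \<le> card (T \<rightarrow>\<^sub>E {..D})"
    unfolding box_monomials_def using assms by (intro card_image_le finite_PiE) auto
  also have "\<dots> = (D + 1) ^ card T"
    using assms by (simp add: card_PiE)
  finally show ?thesis .
qed

lemma box_monomials_mono: "D \<le> E \<Longrightarrow> box_monomials T D \<subseteq> box_monomials T E"
  unfolding box_monomials_def by (intro image_mono PiE_mono) auto

lemma one_in_box_monomials: "1 \<in> box_monomials T D"
  unfolding box_monomials_def by (rule image_eqI[where x = "restrict (\<lambda>_. 0) T"]) auto

lemma mem_box_monomials:
  assumes "finite T" "t \<in> T"
  shows "t \<in> box_monomials T 1"
proof -
  have "(\<Prod>s\<in>T. s ^ (if s = t then 1 else 0)) = t"
    using assms by (simp add: if_distrib[of "power _"] prod.delta cong: if_cong)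
  then show ?thesis
    unfolding box_monomials_def
    by (intro image_eqI[where x = "restrict (\<lambda>s. if s = t then 1 else 0) T"]) auto
qed

lemma box_monomials_mult:
  assumes "m \<in> box_monomials T D" "m' \<in> box_monomials T E"
  shows "m * m' \<in> box_monomials T (D + E)"
proof -
  obtain e e' where e: "e \<in> T \<rightarrow>\<^sub>E {..D}" "m = (\<Prod>t\<in>T. t ^ e t)"
    and e': "e' \<in> T \<rightarrow>\<^sub>E {..E}" "m' = (\<Prod>t\<in>T. t ^ e' t)"
    using assms unfolding box_monomials_def by blast
  have "restrict (\<lambda>t. e t + e' t) T \<in> T \<rightarrow>\<^sub>E {..D + E}"
    using e e' by (auto simp: PiE_def Pi_def add_mono)
  moreover have "m * m' = (\<Prod>t\<in>T. t ^ restrict (\<lambda>t. e t + e' t) T t)"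
    using e e' by (simp add: power_add prod.distrib)
  ultimately show ?thesis
    unfolding box_monomials_def by blast
qed

lemma module_upto_mono: "V \<subseteq> W \<Longrightarrow> D \<le> E \<Longrightarrow> module_upto T V D \<subseteq> module_upto T W E"
  unfolding module_upto_def using box_monomials_mono[of D E T]
  by (intro rat_vs.span_mono image_mono Sigma_mono) auto

lemma module_upto_gen: "m \<in> box_monomials T D \<Longrightarrow> w \<in> W \<Longrightarrow> m * w \<in> module_upto T W D"
  unfolding module_upto_def by (rule rat_vs.span_base) auto

lemma mem_module_upto: "w \<in> W \<Longrightarrow> w \<in> module_upto T W D"
  using module_upto_gen[OF one_in_box_monomials] by fastforce

lemma module_upto_mult:
  assumes "x \<in> module_upto T V D" "y \<in> module_upto T W E"
  shows "x * y \<in> module_upto T ((\<lambda>(v, w). v * w) ` (V \<times> W)) (D + E)"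
  using assms unfolding module_upto_def
proof (rule span_mult)
  fix a b
  assume "a \<in> (\<lambda>(m, w). m * w) ` (box_monomials T D \<times> V)"
    and "b \<in> (\<lambda>(m, w). m * w) ` (box_monomials T E \<times> W)"
  then obtain m v m' w where "a = m * v" "b = m' * w"
    and m: "m \<in> box_monomials T D" "m' \<in> box_monomials T E" and "v \<in> V" "w \<in> W"
    by auto
  then have "a * b = (m * m') * (v * w)" "v * w \<in> (\<lambda>(v, w). v * w) ` (V \<times> W)"
    by (auto simp: mult_ac)
  with module_upto_gen[OF box_monomials_mult[OF m], of "v * w"]
  show "a * b \<in> rat_vs.span ((\<lambda>(m, w). m * w) `
      (box_monomials T (D + E) \<times> (\<lambda>(v, w). v * w) ` (V \<times> W)))"
    unfolding module_upto_def by simp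
qed

lemma stabilises_mult_mem:
  assumes "stabilises T W D x" "y \<in> module_upto T W E"
  shows "x * y \<in> module_upto T W (D + E)"
proof -
  have "y * x \<in> rat_vs.span ((\<lambda>(m, w). m * w) ` (box_monomials T (D + E) \<times> W))"
    using assms(2)[unfolded module_upto_def]
  proof (rule span_mult_right, safe)
    fix m w assume m: "m \<in> box_monomials T E" and w: "w \<in> W"
    have "x * w \<in> module_upto T W D"
      using assms(1) w by (simp add: stabilises_def)
    then have "(x * w) * m \<in> module_upto T W (D + E)"
      unfolding module_upto_def
    proof (rule span_mult_right, safe)
      fix m' w' assume m': "m' \<in> box_monomials T D" "w' \<in> W"
      from module_upto_gen[OF box_monomials_mult[OF m'(1) m] m'(2)]
      show "m' * w' * m \<in> rat_vs.span ((\<lambda>(m, w). m * w) ` (box_monomials T (D + E) \<times> W))"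
        by (simp add: module_upto_def mult_ac)
    qed
    then show "m * w * x \<in> rat_vs.span ((\<lambda>(m, w). m * w) ` (box_monomials T (D + E) \<times> W))"
      by (simp add: module_upto_def mult_ac)
  qed
  then show ?thesis by (simp add: module_upto_def mult.commute)
qed

lemma stabilises_one: "stabilises T W 0 1"
  by (simp add: stabilises_def mem_module_upto)

lemma stabilises_mult:
  assumes "stabilises T W D x" "stabilises T W E y"
  shows "stabilises T W (D + E) (x * y)"
  using stabilises_mult_mem[OF assms(1)] assms(2) by (auto simp: stabilises_def mult.assoc)

lemma stabilises_power: "stabilises T W D x \<Longrightarrow> stabilises T W (n * D) (x ^ n)"
  by (induction n) (auto simp: stabilises_one intro: stabilises_mult)

lemma stabilises_prod:
  assumes "finite A" "\<And>a. a \<in> A \<Longrightarrow> stabilises T W D (f a)"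
  shows "stabilises T W (card A * D) (\<Prod>a\<in>A. f a)"
  using assms by (induction A rule: finite_induct) (auto simp: stabilises_one intro: stabilises_mult)

lemma stabilises_add: "stabilises T W D x \<Longrightarrow> stabilises T W D y \<Longrightarrow> stabilises T W D (x + y)"
  unfolding stabilises_def module_upto_def by (auto simp: distrib_right intro: rat_vs.span_add)

lemma stabilises_uminus: "stabilises T W D x \<Longrightarrow> stabilises T W D (- x)"
  unfolding stabilises_def module_upto_def by (auto intro: rat_vs.span_neg)

text \<open>
  The products of the generators of two modules generate a module that is stable under the
  multipliers of both. Finitely many integral elements can thus be treated over one module, where
  their sums and products visibly act, and where degrees can be added up.
\<close>
lemma common_module:
  assumes "finite X" "\<forall>x\<in>X. poly_integral T x"
  shows "\<exists>W D. finite W \<and> 1 \<in> W \<and> (\<forall>x\<in>X. stabilises T W D x)"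
  using assms
proof (induction X rule: finite_induct)
  case empty
  show ?case by (rule exI[of _ "{1}"]) simp
next
  case (insert y X)
  then obtain V D where V: "finite V" "1 \<in> V" "\<forall>x\<in>X. stabilises T V D x"
    by auto
  obtain W E where W: "finite W" "1 \<in> W" "stabilises T W E y"
    using insert.prems unfolding poly_integral_def by blast
  let ?P = "(\<lambda>(v, w). v * w) ` (V \<times> W)"
  have old: "stabilises T ?P (D + E) x" if "x \<in> X" for x
    unfolding stabilises_def
  proof safe
    fix v w assume vw: "v \<in> V" "w \<in> W"
    have "x * v \<in> module_upto T V D"
      using V that vw by (simp add: stabilises_def)
    from module_upto_mult[OF this mem_module_upto[OF vw(2)], of E]
    show "x * (v * w) \<in> module_upto T ?P (D + E)" by (simp add: mult.assoc)
  qed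
  have new: "stabilises T ?P (D + E) y"
    unfolding stabilises_def
  proof safe
    fix v w assume vw: "v \<in> V" "w \<in> W"
    have "y * w \<in> module_upto T W E"
      using W vw by (simp add: stabilises_def)
    from module_upto_mult[OF mem_module_upto[OF vw(1)] this, of D]
    show "y * (v * w) \<in> module_upto T ?P (D + E)" by (simp add: mult_ac)
  qed
  have "1 \<in> ?P"
    using V W by (intro image_eqI[where x = "(1, 1)"]) auto
  then show ?case
    using V W old new by (intro exI[of _ ?P] exI[of _ "D + E"]) auto
qed

lemma poly_integral_mem: "finite T \<Longrightarrow> t \<in> T \<Longrightarrow> poly_integral T t"
  unfolding poly_integral_def stabilises_def
  using module_upto_gen[OF mem_box_monomials, of T t 1 "{1}"]
  by (intro exI[of _ "{1}"] exI[of _ 1]) auto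

lemma poly_integral_1: "poly_integral T 1"
  unfolding poly_integral_def using stabilises_one by (intro exI[of _ "{1}"]) auto

lemma poly_integral_0: "poly_integral T 0"
  unfolding poly_integral_def stabilises_def module_upto_def
  by (intro exI[of _ "{1}"]) (auto intro: rat_vs.span_zero)

lemma poly_integral_uminus: "poly_integral T x \<Longrightarrow> poly_integral T (- x)"
  unfolding poly_integral_def using stabilises_uminus by blast

lemma
  assumes "poly_integral T x" "poly_integral T y"
  shows poly_integral_add: "poly_integral T (x + y)"
    and poly_integral_mult: "poly_integral T (x * y)"
proof -
  obtain W D where W: "finite W" "1 \<in> W"
    and "stabilises T W D x" "stabilises T W D y"
    using common_module[of "{x, y}" T] assms by auto
  then have "stabilises T W D (x + y)" "stabilises T W (D + D) (x * y)"
    by (simp_all add: stabilises_add stabilises_mult)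
  with W show "poly_integral T (x + y)" "poly_integral T (x * y)"
    unfolding poly_integral_def by blast+
qed

lemma poly_integral_prod:
  "(\<And>a. a \<in> A \<Longrightarrow> poly_integral T (f a)) \<Longrightarrow> poly_integral T (\<Prod>a\<in>A. f a)"
  by (induction A rule: infinite_finite_induct) (auto simp: poly_integral_1 intro: poly_integral_mult)

text \<open>
  If \<open>x\<^sup>2\<close> preserves the module generated by \<open>W\<close>, then \<open>x\<close> preserves the one generated by \<open>W\<close> and \<open>x W\<close>:
  it maps \<open>W\<close> to \<open>x W\<close>, and \<open>x W\<close> to \<open>x\<^sup>2 W\<close>.
\<close>
lemma poly_integral_sqrt:
  assumes "poly_integral T (x\<^sup>2)"
  shows "poly_integral T x"
proof -
  obtain W D where W: "finite W" "1 \<in> W" "stabilises T W D (x\<^sup>2)"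
    using assms unfolding poly_integral_def by blast
  let ?W = "W \<union> (\<lambda>w. x * w) ` W"
  have "stabilises T ?W D x"
    unfolding stabilises_def
  proof safe
    fix w assume w: "w \<in> W"
    then show "x * w \<in> module_upto T ?W D"
      by (intro mem_module_upto) auto
    have "x\<^sup>2 * w \<in> module_upto T W D"
      using W w by (simp add: stabilises_def)
    then show "x * (x * w) \<in> module_upto T ?W D"
      using module_upto_mono[of W ?W D D T] by (auto simp: power2_eq_square mult.assoc)
  qed
  then show ?thesis
    unfolding poly_integral_def using W by (intro exI[of _ ?W] exI[of _ D]) auto
qed

section \<open>Fields closed under square roots\<close>

text \<open>
  A Euclidean field: every element that has a real square root has one in the field.
\<close>
definition euclidean_subfield :: "real set \<Rightarrow> bool" where
  "euclidean_subfield F \<longleftrightarrow> real_subfield F \<and> (\<forall>x. x\<^sup>2 \<in> F \<longrightarrow> x \<in> F)"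

text \<open>
  Passing to fractions supplies inverses without any discussion of minimal polynomials.
\<close>
definition integral_fractions :: "real set \<Rightarrow> real set" where
  "integral_fractions T = {f / g | f g. poly_integral T f \<and> poly_integral T g \<and> g \<noteq> 0}"

lemma integral_fractionsI:
  "poly_integral T f \<Longrightarrow> poly_integral T g \<Longrightarrow> g \<noteq> 0 \<Longrightarrow> x = f / g \<Longrightarrow> x \<in> integral_fractions T"
  unfolding integral_fractions_def by blast

text \<open>
  For square roots: if \<open>x\<^sup>2 = f / g\<close> then \<open>(x g)\<^sup>2 = f g\<close> is integral, hence so is \<open>x g\<close>.
\<close>
lemma euclidean_subfield_integral_fractions: "euclidean_subfield (integral_fractions T)"
  unfolding euclidean_subfield_def real_subfield_def
proof (intro conjI ballI allI impI)
  show "0 \<in> integral_fractions T"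
    by (rule integral_fractionsI[of T 0 1]) (auto simp: poly_integral_0 poly_integral_1)
  show "1 \<in> integral_fractions T"
    by (rule integral_fractionsI[of T 1 1]) (auto simp: poly_integral_1)
  fix x assume "x \<in> integral_fractions T"
  then obtain f g where fg: "poly_integral T f" "poly_integral T g" "g \<noteq> 0" "x = f / g"
    unfolding integral_fractions_def by blast
  show "- x \<in> integral_fractions T"
    using fg by (intro integral_fractionsI[of T "- f" g]) (auto intro: poly_integral_uminus)
  show "inverse x \<in> integral_fractions T"
  proof (cases "f = 0")
    case True
    then show ?thesis
      using fg by (intro integral_fractionsI[of T 0 g]) (auto simp: poly_integral_0)
  next
    case False
    then show ?thesis
      using fg by (intro integral_fractionsI[of T g f]) auto
  qed
  fix y assume "y \<in> integral_fractions T"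
  then obtain f' g' where fg': "poly_integral T f'" "poly_integral T g'" "g' \<noteq> 0" "y = f' / g'"
    unfolding integral_fractions_def by blast
  show "x + y \<in> integral_fractions T"
    using fg fg' by (intro integral_fractionsI[of T "f * g' + f' * g" "g * g'"])
      (auto intro!: poly_integral_add poly_integral_mult simp: add_frac_eq)
  show "x * y \<in> integral_fractions T"
    using fg fg' by (intro integral_fractionsI[of T "f * f'" "g * g'"])
      (auto intro!: poly_integral_mult)
next
  fix x :: real assume "x\<^sup>2 \<in> integral_fractions T"
  then obtain f g where fg: "poly_integral T f" "poly_integral T g" "g \<noteq> 0" "x\<^sup>2 = f / g"
    unfolding integral_fractions_def by blast
  then have "(x * g)\<^sup>2 = f * g"
    by (simp only: power_mult_distrib) (simp add: power2_eq_square)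
  then have "poly_integral T ((x * g)\<^sup>2)"
    using poly_integral_mult[OF fg(1,2)] by simp
  then have "poly_integral T (x * g)"
    by (rule poly_integral_sqrt)
  then show "x \<in> integral_fractions T"
    using fg by (intro integral_fractionsI[of T "x * g" g]) auto
qed

section \<open>A bound for the transcendence degree\<close>

text \<open>
  Algebraic independence restated as linear independence of the monomials in a box of exponents. The
  proof translates a family of coefficients into a formal polynomial in the variables \<open>B\<close>.
\<close>
lemma alg_independent_monomials:
  assumes B: "finite B" "alg_independent B"
    and zero: "(\<Sum>\<alpha>\<in>B \<rightarrow>\<^sub>E {..N}. of_rat (q \<alpha>) * (\<Prod>b\<in>B. b ^ \<alpha> b)) = 0"
  shows "\<forall>\<alpha>\<in>B \<rightarrow>\<^sub>E {..N}. q \<alpha> = 0"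
proof
  fix \<beta> assume \<beta>: "\<beta> \<in> B \<rightarrow>\<^sub>E {..N}"
  let ?A = "B \<rightarrow>\<^sub>E {..N}"
  have A: "finite ?A" using B by (intro finite_PiE) auto
  define mon :: "(real \<Rightarrow> nat) \<Rightarrow> (real \<Rightarrow>\<^sub>0 nat)"
    where "mon \<alpha> = Abs_poly_mapping (\<lambda>b. if b \<in> B then \<alpha> b else 0)" for \<alpha>
  have lookup_mon: "Poly_Mapping.lookup (mon \<alpha>) b = (if b \<in> B then \<alpha> b else 0)" for \<alpha> b
    unfolding mon_def using B by (subst lookup_Abs_poly_mapping) (auto intro: finite_subset[of _ B])
  have keys_mon: "Poly_Mapping.keys (mon \<alpha>) \<subseteq> B" for \<alpha>
    by (auto simp: in_keys_iff lookup_mon split: if_splits)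
  have inj: "inj_on mon ?A"
  proof (rule inj_onI)
    fix \<alpha> \<gamma> assume ag: "\<alpha> \<in> ?A" "\<gamma> \<in> ?A" "mon \<alpha> = mon \<gamma>"
    show "\<alpha> = \<gamma>"
    proof (rule PiE_ext[OF ag(1,2)])
      fix b assume "b \<in> B"
      then show "\<alpha> b = \<gamma> b" using lookup_mon[of \<alpha> b] lookup_mon[of \<gamma> b] ag(3) by simp
    qed
  qed
  define P :: "(real \<Rightarrow>\<^sub>0 nat) \<Rightarrow>\<^sub>0 rat"
    where "P = Abs_poly_mapping (\<lambda>m. if m \<in> mon ` ?A then q (the_inv_into ?A mon m) else 0)"
  have lookup_P:
    "Poly_Mapping.lookup P m = (if m \<in> mon ` ?A then q (the_inv_into ?A mon m) else 0)" for m
    unfolding P_def using A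
    by (subst lookup_Abs_poly_mapping) (auto intro: finite_subset[of _ "mon ` ?A"])
  have lookup_P_mon: "Poly_Mapping.lookup P (mon \<alpha>) = q \<alpha>" if "\<alpha> \<in> ?A" for \<alpha>
    using that by (simp add: lookup_P the_inv_into_f_f[OF inj])
  have keys_P: "Poly_Mapping.keys P \<subseteq> mon ` ?A"
    by (auto simp: in_keys_iff lookup_P split: if_splits)
  have eval_mon: "(\<Prod>b\<in>Poly_Mapping.keys (mon \<alpha>). b ^ Poly_Mapping.lookup (mon \<alpha>) b)
      = (\<Prod>b\<in>B. b ^ \<alpha> b)" for \<alpha>
  proof -
    have "(\<Prod>b\<in>Poly_Mapping.keys (mon \<alpha>). b ^ Poly_Mapping.lookup (mon \<alpha>) b)
      = (\<Prod>b\<in>B. b ^ Poly_Mapping.lookup (mon \<alpha>) b)"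
      using B keys_mon by (intro prod.mono_neutral_left) (auto simp: in_keys_iff)
    then show ?thesis by (simp add: lookup_mon)
  qed
  have "self_eval P = (\<Sum>m\<in>mon ` ?A. of_rat (Poly_Mapping.lookup P m) *
        (\<Prod>b\<in>Poly_Mapping.keys m. b ^ Poly_Mapping.lookup m b))"
    unfolding self_eval_def using A keys_P
    by (intro sum.mono_neutral_left) (auto simp: in_keys_iff)
  also have "\<dots> = (\<Sum>\<alpha>\<in>?A. of_rat (q \<alpha>) * (\<Prod>b\<in>B. b ^ \<alpha> b))"
    by (simp add: sum.reindex[OF inj] eval_mon lookup_P_mon)
  finally have "self_eval P = 0" using zero by simp
  moreover have "\<forall>m\<in>Poly_Mapping.keys P. Poly_Mapping.keys m \<subseteq> B"
    using keys_P keys_mon by blast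
  ultimately have "P = 0"
    using B by (auto simp: alg_independent_def)
  then show "q \<beta> = 0"
    using lookup_P_mon[OF \<beta>] by simp
qed

text \<open>
  Suppose \<open>d = card B\<close> exceeds \<open>card T\<close>. With a common denominator \<open>G\<close>, each \<open>G ^ (d N) * b\<^sup>\<alpha>\<close> with
  exponents at most \<open>N\<close> is a product of \<open>d N\<close> integral elements out of a fixed finite set, so it lies
  in the part of degree at most \<open>d N D\<close> of a fixed \<open>\<rat>[T]\<close>-module with generators \<open>W\<close>. There are
  \<open>(N + 1) ^ d\<close> such elements, linearly independent over \<open>\<rat>\<close>, in a space of dimension at most
  \<open>card W * (d N D + 1) ^ card T\<close>, which is too small for large \<open>N\<close>.
\<close>
lemma card_alg_independent_le:
  assumes T: "finite T" and B: "finite B" "alg_independent B" "B \<subseteq> integral_fractions T"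
  shows "card B \<le> card T"
proof (rule ccontr)
  assume less: "\<not> card B \<le> card T"
  have "\<forall>b\<in>B. \<exists>f g. poly_integral T f \<and> poly_integral T g \<and> g \<noteq> 0 \<and> b = f / g"
    using B(3) unfolding integral_fractions_def by blast
  then obtain f g where fg: "\<And>b. b \<in> B \<Longrightarrow> poly_integral T (f b)"
    "\<And>b. b \<in> B \<Longrightarrow> poly_integral T (g b)" "\<And>b. b \<in> B \<Longrightarrow> g b \<noteq> 0"
    "\<And>b. b \<in> B \<Longrightarrow> b = f b / g b"
    by metis
  define G where "G = (\<Prod>b\<in>B. g b)"
  have G0: "G \<noteq> 0" using fg(3) B(1) by (simp add: G_def)
  have G: "poly_integral T G" unfolding G_def using fg(2) by (rule poly_integral_prod)
  have bG: "poly_integral T (b * G)" if b: "b \<in> B" for b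
  proof -
    have "b * G = b * g b * (\<Prod>b\<in>B - {b}. g b)"
      unfolding G_def using B(1) b by (simp add: prod.remove)
    also have "b * g b = f b" using fg(3,4)[OF b] by (metis nonzero_eq_divide_eq)
    finally show ?thesis
      using fg(1)[OF b] fg(2) by (auto intro!: poly_integral_mult poly_integral_prod)
  qed
  have "finite (insert G ((\<lambda>b. b * G) ` B))"
    and "\<forall>x\<in>insert G ((\<lambda>b. b * G) ` B). poly_integral T x"
    using B(1) G bG by auto
  from common_module[OF this] obtain W D where W: "finite W" "1 \<in> W"
    and stab: "\<forall>x\<in>insert G ((\<lambda>b. b * G) ` B). stabilises T W D x"
    by (elim exE conjE)
  define d where "d = card B"
  \<comment> \<open>Chosen so that \<open>N + 1\<close> exceeds the constant in the dimension bound.\<close>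
  define N where "N = card W * (d * D + 1) ^ card T"
  let ?A = "B \<rightarrow>\<^sub>E {..N}"
  have A: "finite ?A" using B by (intro finite_PiE) auto
  let ?x = "\<lambda>\<alpha>. G ^ (d * N) * (\<Prod>b\<in>B. b ^ \<alpha> b)"
  let ?S = "(\<lambda>(m, w). m * w) ` (box_monomials T (d * (N * D)) \<times> W)"
  have "card ?A \<le> card ?S"
  proof (rule card_le_of_independent_family[OF A])
    show "finite ?S" using W finite_box_monomials[OF T] by auto
    show "?x ` ?A \<subseteq> rat_vs.span ?S"
    proof safe
      fix \<alpha> assume \<alpha>: "\<alpha> \<in> ?A"
      \<comment> \<open>Padding each power of \<open>b G\<close> with powers of \<open>G\<close> gives every factor the same weight \<open>N\<close>.\<close>
      have "?x \<alpha> = (\<Prod>b\<in>B. G ^ N * b ^ \<alpha> b)"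
        using B(1) by (simp add: prod.distrib d_def power_mult[symmetric] mult.commute)
      also have "\<dots> = (\<Prod>b\<in>B. (b * G) ^ \<alpha> b * G ^ (N - \<alpha> b))"
      proof (rule prod.cong[OF refl])
        fix b assume "b \<in> B"
        then have "\<alpha> b \<le> N" using \<alpha> by (auto simp: PiE_def Pi_def)
        then have "G ^ N = G ^ \<alpha> b * G ^ (N - \<alpha> b)" by (simp flip: power_add)
        then show "G ^ N * b ^ \<alpha> b = (b * G) ^ \<alpha> b * G ^ (N - \<alpha> b)"
          by (simp add: power_mult_distrib mult_ac)
      qed
      finally have x: "?x \<alpha> = (\<Prod>b\<in>B. (b * G) ^ \<alpha> b * G ^ (N - \<alpha> b))" .
      have "stabilises T W (card B * (N * D)) (\<Prod>b\<in>B. (b * G) ^ \<alpha> b * G ^ (N - \<alpha> b))"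
      proof (rule stabilises_prod[OF B(1)])
        fix b assume b: "b \<in> B"
        then have "\<alpha> b \<le> N" using \<alpha> by (auto simp: PiE_def Pi_def)
        then have "\<alpha> b * D + (N - \<alpha> b) * D = N * D" by (simp flip: add_mult_distrib)
        moreover have "stabilises T W (\<alpha> b * D + (N - \<alpha> b) * D) ((b * G) ^ \<alpha> b * G ^ (N - \<alpha> b))"
          using b stab by (intro stabilises_mult stabilises_power) auto
        ultimately show "stabilises T W (N * D) ((b * G) ^ \<alpha> b * G ^ (N - \<alpha> b))" by simp
      qed
      then have "?x \<alpha> * 1 \<in> module_upto T W (d * (N * D))"
        unfolding x[symmetric] d_def[symmetric] stabilises_def using W(2) by (rule bspec)
      then show "?x \<alpha> \<in> rat_vs.span ?S" by (simp add: module_upto_def)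
    qed
    fix q assume zero: "(\<Sum>\<alpha>\<in>?A. of_rat (q \<alpha>) * ?x \<alpha>) = 0"
    have "(\<Sum>\<alpha>\<in>?A. of_rat (q \<alpha>) * ?x \<alpha>)
        = G ^ (d * N) * (\<Sum>\<alpha>\<in>?A. of_rat (q \<alpha>) * (\<Prod>b\<in>B. b ^ \<alpha> b))"
      unfolding sum_distrib_left by (rule sum.cong[OF refl]) (rule mult.left_commute)
    from trans[OF this[symmetric] zero]
    have "(\<Sum>\<alpha>\<in>?A. of_rat (q \<alpha>) * (\<Prod>b\<in>B. b ^ \<alpha> b)) = 0"
      unfolding mult_eq_0_iff using G0 by simp
    then show "\<forall>\<alpha>\<in>?A. q \<alpha> = 0"
      by (rule alg_independent_monomials[OF B(1,2)])
  qed
  moreover have "card ?A = (N + 1) ^ d"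
    using B(1) by (simp add: card_PiE d_def)
  moreover have "card ?S \<le> ((d * D + 1) * (N + 1)) ^ card T * card W"
  proof -
    have "card ?S \<le> card (box_monomials T (d * (N * D)) \<times> W)"
      using W finite_box_monomials[OF T] by (intro card_image_le finite_cartesian_product)
    also have "\<dots> \<le> (d * (N * D) + 1) ^ card T * card W"
      using card_box_monomials[OF T] unfolding card_cartesian_product by (rule mult_le_mono1)
    also have "\<dots> \<le> ((d * D + 1) * (N + 1)) ^ card T * card W"
      by (intro mult_le_mono1 power_mono) (auto simp: algebra_simps)
    finally show ?thesis .
  qed
  ultimately have "(N + 1) ^ d \<le> ((d * D + 1) * (N + 1)) ^ card T * card W"
    by simp
  also have "\<dots> = (card W * (d * D + 1) ^ card T) * (N + 1) ^ card T"
    by (simp only: power_mult_distrib mult_ac)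
  also have "\<dots> = N * (N + 1) ^ card T"
    by (simp only: N_def[symmetric])
  also have "\<dots> < (N + 1) ^ (card T + 1)" by simp
  also have "\<dots> \<le> (N + 1) ^ d"
    using less by (intro power_increasing) (auto simp: d_def)
  finally show False by simp
qed

definition euclidean_closure :: "real set \<Rightarrow> real set" where
  "euclidean_closure S = euclidean_subfield hull S"

text \<open>
  All numbers constructible by square roots from \<open>T\<close> are fractions of integral elements, and
  these already form a field, so the field generated by \<open>S\<close> contains no others.
\<close>
lemma transcendence_degree_le_card:
  assumes "finite T" "S \<subseteq> euclidean_closure T" "has_transcendence_degree (rat_adjoin S) d"
  shows "d \<le> card T"
proof -
  obtain B where B: "B \<subseteq> rat_adjoin S" "alg_independent B" "finite B" "card B = d"
    using assms(3) unfolding has_transcendence_degree_def transcendence_basis_def by blast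
  have "T \<subseteq> integral_fractions T"
    using poly_integral_mem[OF assms(1)] poly_integral_1
    by (auto intro!: integral_fractionsI[of T _ 1])
  then have "euclidean_closure T \<subseteq> integral_fractions T"
    unfolding euclidean_closure_def
    using euclidean_subfield_integral_fractions by (rule hull_minimal)
  then have "rat_adjoin S \<subseteq> integral_fractions T"
    unfolding rat_adjoin_def using assms(2) euclidean_subfield_integral_fractions
    by (intro hull_minimal) (auto simp: euclidean_subfield_def)
  then show ?thesis
    using card_alg_independent_le[OF assms(1) B(3,2)] B by blast
qed

section \<open>Calculating in the closure under square roots\<close>

lemma euclidean_closure_mono: "S \<subseteq> T \<Longrightarrow> euclidean_closure S \<subseteq> euclidean_closure T"
  unfolding euclidean_closure_def by (rule hull_mono)

lemma euclidean_closure_inc: "x \<in> S \<Longrightarrow> x \<in> euclidean_closure S"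
  unfolding euclidean_closure_def by (rule hull_inc)

lemma euclidean_closure_minimal:
  "S \<subseteq> euclidean_closure T \<Longrightarrow> euclidean_closure S \<subseteq> euclidean_closure T"
  unfolding euclidean_closure_def using hull_mono[of S _ euclidean_subfield] by (metis hull_hull)

lemma euclidean_subfield_closure: "euclidean_subfield (euclidean_closure S)"
  unfolding euclidean_closure_def
  by (rule hull_in) (auto simp: euclidean_subfield_def real_subfield_def)

context
  fixes S :: "real set"
begin

lemma shows euclidean_closure_0: "0 \<in> euclidean_closure S"
    and euclidean_closure_1: "1 \<in> euclidean_closure S"
  using euclidean_subfield_closure[of S] by (auto simp: euclidean_subfield_def real_subfield_def)

lemma assumes "x \<in> euclidean_closure S"
  shows euclidean_closure_uminus: "- x \<in> euclidean_closure S"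
    and euclidean_closure_inverse: "inverse x \<in> euclidean_closure S"
  using euclidean_subfield_closure[of S] assms by (auto simp: euclidean_subfield_def real_subfield_def)

lemma assumes "x \<in> euclidean_closure S" "y \<in> euclidean_closure S"
  shows euclidean_closure_add: "x + y \<in> euclidean_closure S"
    and euclidean_closure_mult: "x * y \<in> euclidean_closure S"
  using euclidean_subfield_closure[of S] assms by (auto simp: euclidean_subfield_def real_subfield_def)

lemma euclidean_closure_sqrt: "x\<^sup>2 \<in> euclidean_closure S \<Longrightarrow> x \<in> euclidean_closure S"
  using euclidean_subfield_closure[of S] by (auto simp: euclidean_subfield_def)

lemma euclidean_closure_diff:
  "x \<in> euclidean_closure S \<Longrightarrow> y \<in> euclidean_closure S \<Longrightarrow> x - y \<in> euclidean_closure S"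
  using euclidean_closure_add[of x "- y"] euclidean_closure_uminus by simp

lemma euclidean_closure_divide:
  "x \<in> euclidean_closure S \<Longrightarrow> y \<in> euclidean_closure S \<Longrightarrow> x / y \<in> euclidean_closure S"
  using euclidean_closure_mult[of x "inverse y"] euclidean_closure_inverse
  by (simp add: divide_inverse)

lemma euclidean_closure_power: "x \<in> euclidean_closure S \<Longrightarrow> x ^ n \<in> euclidean_closure S"
  by (induction n) (auto intro: euclidean_closure_1 euclidean_closure_mult)

lemma euclidean_closure_of_nat: "of_nat n \<in> euclidean_closure S"
  by (induction n) (auto intro: euclidean_closure_0 euclidean_closure_1 euclidean_closure_add)

lemma euclidean_closure_of_int: "of_int i \<in> euclidean_closure S"
  by (cases i rule: int_cases2) (auto intro: euclidean_closure_of_nat euclidean_closure_uminus)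

lemma euclidean_closure_of_rat: "of_rat r \<in> euclidean_closure S"
  by (induction r) (simp add: of_rat_rat euclidean_closure_divide euclidean_closure_of_int)

lemma euclidean_closure_numeral: "numeral n \<in> euclidean_closure S"
  using euclidean_closure_of_nat[of "numeral n"] by simp

text \<open>
  Completing the square: \<open>2 A x + B\<close> is a square root of the discriminant.
\<close>
lemma euclidean_closure_quadratic:
  assumes "A \<in> euclidean_closure S" "B \<in> euclidean_closure S" "C \<in> euclidean_closure S"
    and "A \<noteq> 0" and root: "A * x\<^sup>2 + B * x + C = 0"
  shows "x \<in> euclidean_closure S"
proof -
  have "(2 * A * x + B)\<^sup>2 = B\<^sup>2 - 4 * (A * C)"
    using root by (simp add: power2_eq_square) algebra
  also have "\<dots> \<in> euclidean_closure S"
    using assms by (intro euclidean_closure_diff euclidean_closure_power euclidean_closure_mult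
        euclidean_closure_numeral)
  finally have "2 * A * x + B \<in> euclidean_closure S"
    by (rule euclidean_closure_sqrt)
  then have "(2 * A * x + B - B) / (2 * A) \<in> euclidean_closure S"
    using assms by (intro euclidean_closure_divide euclidean_closure_diff euclidean_closure_mult
        euclidean_closure_numeral)
  then show ?thesis using assms by simp
qed

end

lemmas euclidean_closure_intros =
  euclidean_closure_0 euclidean_closure_1 euclidean_closure_uminus euclidean_closure_add
  euclidean_closure_mult euclidean_closure_diff euclidean_closure_divide euclidean_closure_power
  euclidean_closure_of_rat euclidean_closure_numeral

section \<open>Generic points are not confined to curves\<close>

definition coords :: "real ^ 3 \<Rightarrow> real set" where
  "coords x = {x $ 1, x $ 2, x $ 3}"

lemma coords_conv: "coords x = range (\<lambda>i. x $ i)"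
  by (auto simp: coords_def UNIV_3)

text \<open>
  Being two-dimensional in the arithmetic sense: the coordinates of a point are obtained from two
  real numbers by field operations and square roots.
\<close>
definition two_parameter_surface :: "(real ^ 3) set \<Rightarrow> bool" where
  "two_parameter_surface M \<longleftrightarrow> (\<forall>x\<in>M. \<exists>r s. coords x \<subseteq> euclidean_closure {r, s})"

text \<open>
  The \<open>n - 1\<close> other points are determined by two numbers each. If one extra number \<open>r\<close> sufficed for
  \<open>p u\<close>, then \<open>2 n - 1\<close> numbers would determine the whole framework, contradicting transcendence
  degree \<open>2 n\<close>.
\<close>
lemma generic_not_one_parameter:
  assumes gen: "generic_framework G p" and fw: "framework_on M G p"
    and M: "two_parameter_surface M" and fin: "finite (pverts G)" and u: "u \<in> pverts G"
    and r: "coords (p u) \<subseteq> euclidean_closure (insert r (\<Union>v\<in>pverts G - {u}. coords (p v)))"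
  shows False
proof -
  let ?V = "pverts G - {u}"
  have "\<forall>v\<in>?V. \<exists>s t. coords (p v) \<subseteq> euclidean_closure {s, t}"
    using fw M unfolding framework_on_def two_parameter_surface_def by blast
  then obtain s t where st: "\<And>v. v \<in> ?V \<Longrightarrow> coords (p v) \<subseteq> euclidean_closure {s v, t v}"
    by metis
  define T where "T = insert r (s ` ?V \<union> t ` ?V)"
  have "finite T" using fin by (simp add: T_def)
  have others: "coords (p v) \<subseteq> euclidean_closure T" if "v \<in> ?V" for v
    using st[OF that] euclidean_closure_mono[of "{s v, t v}" T] that by (auto simp: T_def)
  have "r \<in> euclidean_closure T"
    by (rule euclidean_closure_inc) (simp add: T_def)
  then have "insert r (\<Union>v\<in>?V. coords (p v)) \<subseteq> euclidean_closure T"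
    using others by blast
  from euclidean_closure_minimal[OF this] r have "coords (p u) \<subseteq> euclidean_closure T"
    by blast
  with others have "{p v $ i | v i. v \<in> pverts G} \<subseteq> euclidean_closure T"
    unfolding coords_conv by blast
  from transcendence_degree_le_card[OF \<open>finite T\<close> this] gen
  have "2 * card (pverts G) \<le> card T"
    by (simp add: generic_framework_def)
  also have "card T \<le> card (s ` ?V \<union> t ` ?V) + 1"
    unfolding T_def using fin by (simp add: card_insert_if)
  also have "\<dots> \<le> card ?V + card ?V + 1"
    using card_Un_le[of "s ` ?V" "t ` ?V"] card_image_le[of ?V s] card_image_le[of ?V t] fin
    by simp
  also have "\<dots> < 2 * card (pverts G)"
    using card_Suc_Diff1[OF fin u] by simp
  finally show False by simp
qed

section \<open>Reflecting one side of a separation\<close>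

definition mirror :: "real ^ 3 \<Rightarrow> real ^ 3 \<Rightarrow> real ^ 3" where
  "mirror c x = x - (2 * (c \<bullet> x) / (c \<bullet> c)) *\<^sub>R c"

lemma mirror_fixes: "c \<bullet> x = 0 \<Longrightarrow> mirror c x = x"
  by (simp add: mirror_def)

lemma dist_mirror: "norm (mirror c x - mirror c y) = norm (x - y)"
proof (cases "c = 0")
  case False
  have "mirror c x - mirror c y = (x - y) - (2 * (c \<bullet> (x - y)) / (c \<bullet> c)) *\<^sub>R c"
    by (simp add: mirror_def inner_diff_right diff_divide_distrib algebra_simps)
  moreover have "(norm (z - (2 * (c \<bullet> z) / (c \<bullet> c)) *\<^sub>R c))\<^sup>2 = (norm z)\<^sup>2" for z
    using False unfolding power2_norm_eq_inner
    by (simp add: inner_diff_left inner_diff_right inner_commute[of z c])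
  ultimately show ?thesis
    by (metis norm_ge_zero power2_eq_imp_eq)
qed (simp add: mirror_def)

lemma norm_diff_mirror_sq:
  assumes "c \<noteq> 0"
  shows "(norm (x - mirror c y))\<^sup>2 = (norm (x - y))\<^sup>2 + 4 * (c \<bullet> x) * (c \<bullet> y) / (c \<bullet> c)"
proof -
  have "c \<bullet> c \<noteq> 0" using assms by simp
  then have expand: "(norm (z + (2 * s / (c \<bullet> c)) *\<^sub>R c))\<^sup>2
      = (norm z)\<^sup>2 + 4 * s * (c \<bullet> z + s) / (c \<bullet> c)" for z s
    unfolding power2_norm_eq_inner inner_add_left inner_add_right
      inner_scaleR_left inner_scaleR_right inner_commute[of z c]
    by (simp add: field_simps)
  have "x - mirror c y = (x - y) + (2 * (c \<bullet> y) / (c \<bullet> c)) *\<^sub>R c"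
    by (simp add: mirror_def)
  then show ?thesis
    by (simp only: expand) (simp add: inner_diff_right mult_ac)
qed

text \<open>
  The witness for \<open>A\<close> is the component of \<open>u\<close> after removing \<open>S\<close>.
\<close>
lemma disconnected_split:
  assumes G: "pair_graph G" and ne: "pverts G - S \<noteq> {}"
    and dis: "\<not> Digraph_Component.connected (with_proj G \<restriction> (pverts G - S))"
  obtains A u v where "u \<in> A" "v \<notin> A" "u \<in> pverts G - S" "v \<in> pverts G - S"
    "\<And>x y. (x, y) \<in> parcs G \<Longrightarrow> x \<notin> S \<Longrightarrow> y \<notin> S \<Longrightarrow> x \<in> A \<longleftrightarrow> y \<in> A"
proof -
  interpret pair_graph G by (rule G)
  let ?H = "with_proj G \<restriction> (pverts G - S)"
  let ?R = "\<lambda>u v. (u, v) \<in> rtrancl_on (verts ?H) ((arcs_ends ?H)\<^sup>s)"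
  have "verts ?H \<noteq> {}" using ne by simp
  then obtain u v where uv: "u \<in> pverts G - S" "v \<in> pverts G - S" "\<not> ?R u v"
    using dis unfolding connected_conv by auto
  have step: "?R u y" if "?R u x" "(x, y) \<in> parcs G \<or> (y, x) \<in> parcs G" "x \<notin> S" "y \<notin> S" for x y
  proof -
    have V: "x \<in> pverts G" "y \<in> pverts G"
      using that(2) in_arcsD1 in_arcsD2 by blast+
    have "(x, y) \<in> (arcs_ends ?H)\<^sup>s"
      using that V by (auto simp: symcl_def arcs_ends_conv)
    moreover have "y \<in> verts ?H"
      using that V by simp
    ultimately show ?thesis
      using that(1) by (blast intro: rtrancl_on.rtrancl_on_into_rtrancl_on[of u x])
  qed
  show thesis
  proof (rule that[of u "{x. ?R u x}" v])
    show "u \<in> {x. ?R u x}" using uv by simp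
    show "v \<notin> {x. ?R u x}" using uv by simp
    show "u \<in> pverts G - S" "v \<in> pverts G - S" by fact+
    fix x y assume "(x, y) \<in> parcs G" "x \<notin> S" "y \<notin> S"
    then show "x \<in> {x. ?R u x} \<longleftrightarrow> y \<in> {x. ?R u x}"
      using step[of x y] step[of y x] by auto
  qed
qed

text \<open>
  The points outside \<open>A\<close> are reflected. The points of \<open>S\<close> lie on the mirror and may be counted on
  either side, so both ends of an edge are either left in place or reflected together.
\<close>
lemma mirror_separator_impossible:
  assumes G: "pair_graph G" and fw: "framework_on M G p" and rigid: "globally_rigid_on M G p"
    and S: "pverts G - S \<noteq> {}"
    and dis: "\<not> Digraph_Component.connected (with_proj G \<restriction> (pverts G - S))"
    and c: "c \<noteq> 0" "mirror c ` M \<subseteq> M"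
    and on: "\<And>v. v \<in> S \<Longrightarrow> c \<bullet> p v = 0"
    and off: "\<And>v. v \<in> pverts G - S \<Longrightarrow> c \<bullet> p v \<noteq> 0"
  shows False
proof -
  obtain A u v where uv: "u \<in> A" "v \<notin> A" "u \<in> pverts G - S" "v \<in> pverts G - S"
    and closed: "\<And>x y. (x, y) \<in> parcs G \<Longrightarrow> x \<notin> S \<Longrightarrow> y \<notin> S \<Longrightarrow> x \<in> A \<longleftrightarrow> y \<in> A"
    using disconnected_split[OF G S dis] by metis
  define q where "q x = (if x \<in> A then p x else mirror c (p x))" for x
  have qS: "q x = p x" "q x = mirror c (p x)" if "x \<in> S" for x
    using on[OF that] by (auto simp: q_def mirror_fixes)
  have "framework_on M G q"
    using fw c(2) by (auto simp: framework_on_def q_def)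
  moreover have "equivalent_frameworks G p q"
    unfolding equivalent_frameworks_def
  proof safe
    fix x y assume e: "(x, y) \<in> parcs G"
    consider "q x = p x" "q y = p y" | "q x = mirror c (p x)" "q y = mirror c (p y)"
      using closed[OF e] qS by (metis q_def)
    then show "norm (p x - p y) = norm (q x - q y)"
      by cases (simp_all add: dist_mirror)
  qed
  ultimately have "congruent_frameworks G p q"
    using rigid by (simp add: globally_rigid_on_def)
  then have "norm (p u - p v) = norm (p u - mirror c (p v))"
    using uv by (auto simp: congruent_frameworks_def q_def)
  then have "4 * (c \<bullet> p u) * (c \<bullet> p v) / (c \<bullet> c) = 0"
    using norm_diff_mirror_sq[OF c(1), of "p u" "p v"] by simp
  then show False
    using off uv c(1) by auto
qed

section \<open>Plane sections of the four surfaces\<close>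

lemma inner_3: "(x :: real ^ 3) \<bullet> y = x $ 1 * y $ 1 + x $ 2 * y $ 2 + x $ 3 * y $ 3"
  by (simp add: inner_vec_def sum_3)

lemma vec3_eq_0_iff: "(c :: real ^ 3) = 0 \<longleftrightarrow> c $ 1 = 0 \<and> c $ 2 = 0 \<and> c $ 3 = 0"
  by (simp add: vec_eq_iff forall_3)

text \<open>
  Eliminating \<open>y\<close> between the line and the circle leaves a quadratic equation for \<open>x\<close> with leading
  coefficient \<open>c1\<^sup>2 + c2\<^sup>2\<close>, which does not vanish.
\<close>
lemma line_circle_in_euclidean_closure:
  assumes "c1 \<in> euclidean_closure S" "c2 \<in> euclidean_closure S"
    and "h \<in> euclidean_closure S" "\<rho> \<in> euclidean_closure S"
    and "c1 \<noteq> 0 \<or> c2 \<noteq> 0" and line: "c1 * x + c2 * y + h = 0" and circle: "x\<^sup>2 + y\<^sup>2 = \<rho>"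
  shows "x \<in> euclidean_closure S"
proof (rule euclidean_closure_quadratic)
  show "c1\<^sup>2 + c2\<^sup>2 \<noteq> 0"
    using assms(5) by (simp add: sum_power2_eq_zero_iff)
  have "c2 * y = - (c1 * x + h)" using line by simp
  then have "(c2 * y)\<^sup>2 = (c1 * x + h)\<^sup>2" by (metis power2_minus)
  then show "(c1\<^sup>2 + c2\<^sup>2) * x\<^sup>2 + (2 * c1 * h) * x + (h\<^sup>2 - c2\<^sup>2 * \<rho>) = 0"
    unfolding circle[symmetric] by (simp add: power2_eq_square algebra_simps)
qed (intro euclidean_closure_intros assms)+

text \<open>
  The span of the first \<open>k\<close> coordinate axes, for \<open>1 \<le> k \<le> 3\<close>.
\<close>
definition mirror_normals :: "nat \<Rightarrow> (real ^ 3) set" where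
  "mirror_normals k = {c. (k < 3 \<longrightarrow> c $ 3 = 0) \<and> (k < 2 \<longrightarrow> c $ 2 = 0)}"

text \<open>
  The three properties of a surface on which the argument rests: its points have two parameters,
  planes with normal in \<open>mirror_normals k\<close> are planes of symmetry, and such a plane meets the surface
  in points with one parameter over the coordinates of the normal.
\<close>
definition mirror_surface :: "(real ^ 3) set \<Rightarrow> nat \<Rightarrow> bool" where
  "mirror_surface M k \<longleftrightarrow> two_parameter_surface M \<and>
     (\<forall>c\<in>mirror_normals k. mirror c ` M \<subseteq> M) \<and>
     (\<forall>c\<in>mirror_normals k. c \<noteq> 0 \<longrightarrow> (\<forall>x\<in>M. c \<bullet> x = 0 \<longrightarrow>
        (\<exists>r. coords x \<subseteq> euclidean_closure (insert r (coords c)))))"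

lemma mirror_component: "c $ i = 0 \<Longrightarrow> mirror c x $ i = x $ i"
  by (simp add: mirror_def)

lemma mirror_sum_squares:
  "(mirror c x $ 1)\<^sup>2 + (mirror c x $ 2)\<^sup>2 + (mirror c x $ 3)\<^sup>2 = (x $ 1)\<^sup>2 + (x $ 2)\<^sup>2 + (x $ 3)\<^sup>2"
proof -
  have "norm (mirror c x) = norm x"
    using dist_mirror[of c x 0] by (simp add: mirror_def)
  then have "(norm (mirror c x))\<^sup>2 = (norm x)\<^sup>2" by simp
  then show ?thesis
    unfolding power2_norm_eq_inner by (simp add: inner_3 power2_eq_square)
qed

lemma coords_subsetI: "x $ 1 \<in> A \<Longrightarrow> x $ 2 \<in> A \<Longrightarrow> x $ 3 \<in> A \<Longrightarrow> coords x \<subseteq> A"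
  by (simp add: coords_def)

lemma coords_in_closure:
  assumes "coords c \<subseteq> S"
  shows "c $ 1 \<in> euclidean_closure S" "c $ 2 \<in> euclidean_closure S" "c $ 3 \<in> euclidean_closure S"
  using assms by (auto simp: coords_def intro: euclidean_closure_inc)

text \<open>
  The surfaces of revolution share the form \<open>x\<^sub>1\<^sup>2 + x\<^sub>2\<^sup>2 = \<rho>\<close>, where \<open>\<rho>\<close> depends only on \<open>x\<^sub>3\<close>. A plane that
  is not horizontal cuts the horizontal circle at height \<open>x\<^sub>3\<close> in the points of a line, so the height
  is the one parameter that is left.
\<close>
lemma plane_section_one_parameter:
  assumes c: "c $ 1 \<noteq> 0 \<or> c $ 2 \<noteq> 0" and plane: "c \<bullet> x = 0"
    and circle: "(x $ 1)\<^sup>2 + (x $ 2)\<^sup>2 = \<rho>"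
    and \<rho>: "\<rho> \<in> euclidean_closure (insert (x $ 3) (coords c))"
  shows "coords x \<subseteq> euclidean_closure (insert (x $ 3) (coords c))"
proof (rule coords_subsetI)
  let ?F = "euclidean_closure (insert (x $ 3) (coords c))"
  have cF: "c $ 1 \<in> ?F" "c $ 2 \<in> ?F" "c $ 3 \<in> ?F"
    by (rule coords_in_closure; blast)+
  show x3: "x $ 3 \<in> ?F"
    by (rule euclidean_closure_inc) simp
  have h: "c $ 3 * x $ 3 \<in> ?F"
    using cF x3 by (intro euclidean_closure_mult)
  show "x $ 1 \<in> ?F"
    using plane by (intro line_circle_in_euclidean_closure[OF cF(1,2) h \<rho> c _ circle]) (simp add: inner_3)
  have "c $ 2 \<noteq> 0 \<or> c $ 1 \<noteq> 0" "(x $ 2)\<^sup>2 + (x $ 1)\<^sup>2 = \<rho>"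
    using c circle by auto
  then show "x $ 2 \<in> ?F"
    using plane by (intro line_circle_in_euclidean_closure[OF cF(2,1) h \<rho>, of "x $ 2" "x $ 1"])
      (simp_all add: inner_3)
qed

text \<open>
  The section by the horizontal plane through the origin has constant height; it is the equator,
  which is parametrised by \<open>x\<^sub>1\<close>.
\<close>
lemma mirror_surface_sphere: "mirror_surface unit_sphere 3"
  unfolding mirror_surface_def two_parameter_surface_def
proof (intro conjI ballI impI)
  fix x :: "real ^ 3" assume "x \<in> unit_sphere"
  then have "(x $ 3)\<^sup>2 = 1 - (x $ 1)\<^sup>2 - (x $ 2)\<^sup>2"
    by (simp add: unit_sphere_def)
  also have "\<dots> \<in> euclidean_closure {x $ 1, x $ 2}"
    by (intro euclidean_closure_intros euclidean_closure_inc) auto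
  finally have "x $ 3 \<in> euclidean_closure {x $ 1, x $ 2}"
    by (rule euclidean_closure_sqrt)
  then have "coords x \<subseteq> euclidean_closure {x $ 1, x $ 2}"
    by (intro coords_subsetI) (auto intro: euclidean_closure_inc)
  then show "\<exists>r s. coords x \<subseteq> euclidean_closure {r, s}"
    by blast
next
  fix c :: "real ^ 3"
  show "mirror c ` unit_sphere \<subseteq> unit_sphere"
    by (auto simp: unit_sphere_def mirror_sum_squares)
  fix x :: "real ^ 3" assume c: "c \<noteq> 0" "c \<bullet> x = 0" and x: "x \<in> unit_sphere"
  show "\<exists>r. coords x \<subseteq> euclidean_closure (insert r (coords c))"
  proof (cases "c $ 1 = 0 \<and> c $ 2 = 0")
    case True
    then have "x $ 3 = 0"
      using c by (simp add: inner_3 vec3_eq_0_iff)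
    then have sq: "(x $ 2)\<^sup>2 = 1 - (x $ 1)\<^sup>2"
      using x by (simp add: unit_sphere_def)
    let ?F = "euclidean_closure (insert (x $ 1) (coords c))"
    have x1: "x $ 1 \<in> ?F" by (rule euclidean_closure_inc) simp
    then have "(x $ 2)\<^sup>2 \<in> ?F"
      unfolding sq by (intro euclidean_closure_intros)
    then have "x $ 2 \<in> ?F"
      by (rule euclidean_closure_sqrt)
    then have "coords x \<subseteq> ?F"
      using x1 \<open>x $ 3 = 0\<close> by (intro coords_subsetI) (auto simp: euclidean_closure_0)
    then show ?thesis ..
  next
    case False
    have "coords x \<subseteq> euclidean_closure (insert (x $ 3) (coords c))"
    proof (rule plane_section_one_parameter)
      show "(x $ 1)\<^sup>2 + (x $ 2)\<^sup>2 = 1 - (x $ 3)\<^sup>2"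
        using x by (simp add: unit_sphere_def)
      show "1 - (x $ 3)\<^sup>2 \<in> euclidean_closure (insert (x $ 3) (coords c))"
        by (intro euclidean_closure_intros euclidean_closure_inc) simp
    qed (use c False in auto)
    then show ?thesis ..
  qed
qed

lemma mirror_surface_cylinder: "mirror_surface unit_cylinder 2"
  unfolding mirror_surface_def two_parameter_surface_def
proof (intro conjI ballI impI)
  fix x :: "real ^ 3" assume "x \<in> unit_cylinder"
  then have "(x $ 2)\<^sup>2 = 1 - (x $ 1)\<^sup>2"
    by (simp add: unit_cylinder_def)
  also have "\<dots> \<in> euclidean_closure {x $ 1, x $ 3}"
    by (intro euclidean_closure_intros euclidean_closure_inc) auto
  finally have "x $ 2 \<in> euclidean_closure {x $ 1, x $ 3}"
    by (rule euclidean_closure_sqrt)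
  then have "coords x \<subseteq> euclidean_closure {x $ 1, x $ 3}"
    by (intro coords_subsetI) (auto intro: euclidean_closure_inc)
  then show "\<exists>r s. coords x \<subseteq> euclidean_closure {r, s}"
    by blast
next
  fix c :: "real ^ 3" assume "c \<in> mirror_normals 2"
  then have c3: "c $ 3 = 0" by (simp add: mirror_normals_def)
  show "mirror c ` unit_cylinder \<subseteq> unit_cylinder"
    using mirror_sum_squares[of c] mirror_component[OF c3] by (auto simp: unit_cylinder_def)
  fix x :: "real ^ 3" assume c: "c \<noteq> 0" "c \<bullet> x = 0" and x: "x \<in> unit_cylinder"
  have "coords x \<subseteq> euclidean_closure (insert (x $ 3) (coords c))"
    using x c c3 by (intro plane_section_one_parameter[of c x 1])
      (auto simp: vec3_eq_0_iff unit_cylinder_def euclidean_closure_1)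
  then show "\<exists>r. coords x \<subseteq> euclidean_closure (insert r (coords c))" ..
qed

lemma mirror_surface_cone: "mirror_surface unit_cone 2"
  unfolding mirror_surface_def two_parameter_surface_def
proof (intro conjI ballI impI)
  fix x :: "real ^ 3" assume "x \<in> unit_cone"
  then have "(x $ 3)\<^sup>2 = (x $ 1)\<^sup>2 + (x $ 2)\<^sup>2"
    by (simp add: unit_cone_def)
  also have "\<dots> \<in> euclidean_closure {x $ 1, x $ 2}"
    by (intro euclidean_closure_intros euclidean_closure_inc) auto
  finally have "x $ 3 \<in> euclidean_closure {x $ 1, x $ 2}"
    by (rule euclidean_closure_sqrt)
  then have "coords x \<subseteq> euclidean_closure {x $ 1, x $ 2}"
    by (intro coords_subsetI) (auto intro: euclidean_closure_inc)
  then show "\<exists>r s. coords x \<subseteq> euclidean_closure {r, s}"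
    by blast
next
  fix c :: "real ^ 3" assume "c \<in> mirror_normals 2"
  then have c3: "c $ 3 = 0" by (simp add: mirror_normals_def)
  show "mirror c ` unit_cone \<subseteq> unit_cone"
    using mirror_sum_squares[of c] mirror_component[OF c3] by (auto simp: unit_cone_def)
  fix x :: "real ^ 3" assume c: "c \<noteq> 0" "c \<bullet> x = 0" and x: "x \<in> unit_cone"
  have "coords x \<subseteq> euclidean_closure (insert (x $ 3) (coords c))"
    using x c c3 by (intro plane_section_one_parameter[of c x "(x $ 3)\<^sup>2"])
      (auto simp: vec3_eq_0_iff unit_cone_def intro: euclidean_closure_power euclidean_closure_inc)
  then show "\<exists>r. coords x \<subseteq> euclidean_closure (insert r (coords c))" ..
qed

text \<open>
  The normals are multiples of the first axis, so the section is the conic in the plane \<open>x\<^sub>1 = 0\<close>,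
  parametrised by \<open>x\<^sub>2\<close>.
\<close>
lemma mirror_surface_ellipsoid:
  assumes "b \<noteq> 0"
  shows "mirror_surface (ellipsoid a b) 1"
  unfolding mirror_surface_def two_parameter_surface_def
proof (intro conjI ballI impI)
  fix x :: "real ^ 3" assume "x \<in> ellipsoid a b"
  then have "(x $ 1)\<^sup>2 = 1 - of_rat a * (x $ 2)\<^sup>2 - of_rat b * (x $ 3)\<^sup>2"
    by (simp add: ellipsoid_def)
  also have "\<dots> \<in> euclidean_closure {x $ 2, x $ 3}"
    by (intro euclidean_closure_intros euclidean_closure_inc) auto
  finally have "x $ 1 \<in> euclidean_closure {x $ 2, x $ 3}"
    by (rule euclidean_closure_sqrt)
  then have "coords x \<subseteq> euclidean_closure {x $ 2, x $ 3}"
    by (intro coords_subsetI) (auto intro: euclidean_closure_inc)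
  then show "\<exists>r s. coords x \<subseteq> euclidean_closure {r, s}"
    by blast
next
  fix c :: "real ^ 3" assume "c \<in> mirror_normals 1"
  then have c23: "c $ 2 = 0" "c $ 3 = 0" by (simp_all add: mirror_normals_def)
  show "mirror c ` ellipsoid a b \<subseteq> ellipsoid a b"
    using mirror_sum_squares[of c] mirror_component[OF c23(1)] mirror_component[OF c23(2)]
    by (auto simp: ellipsoid_def)
  fix x :: "real ^ 3" assume c: "c \<noteq> 0" "c \<bullet> x = 0" and x: "x \<in> ellipsoid a b"
  have x1: "x $ 1 = 0"
    using c c23 by (simp add: inner_3 vec3_eq_0_iff)
  then have sq: "(x $ 3)\<^sup>2 = (1 - of_rat a * (x $ 2)\<^sup>2) / of_rat b"
    using x assms by (simp add: ellipsoid_def eq_divide_eq algebra_simps)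
  let ?F = "euclidean_closure (insert (x $ 2) (coords c))"
  have x2: "x $ 2 \<in> ?F" by (rule euclidean_closure_inc) simp
  then have "(x $ 3)\<^sup>2 \<in> ?F"
    unfolding sq by (intro euclidean_closure_intros)
  then have "x $ 3 \<in> ?F"
    by (rule euclidean_closure_sqrt)
  then have "coords x \<subseteq> ?F"
    using x1 x2 by (intro coords_subsetI) (auto simp: euclidean_closure_0)
  then show "\<exists>r. coords x \<subseteq> euclidean_closure (insert r (coords c))" ..
qed

section \<open>Mirrors through the points of a separator\<close>

text \<open>
  A point on the mirror lies on a plane section of the surface, so it has only one parameter over the
  other points, from which the normal is built.
\<close>
lemma generic_off_mirror:
  assumes M: "mirror_surface M k" and gen: "generic_framework G p" and fw: "framework_on M G p"
    and fin: "finite (pverts G)" and u: "u \<in> pverts G"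
    and c: "c \<in> mirror_normals k" "c \<noteq> 0"
    and cS: "coords c \<subseteq> euclidean_closure (\<Union>v\<in>S. coords (p v))" "S \<subseteq> pverts G - {u}"
  shows "c \<bullet> p u \<noteq> 0"
proof
  assume "c \<bullet> p u = 0"
  moreover have "p u \<in> M" using fw u by (simp add: framework_on_def)
  ultimately obtain r where r: "coords (p u) \<subseteq> euclidean_closure (insert r (coords c))"
    using M c unfolding mirror_surface_def by blast
  let ?U = "insert r (\<Union>v\<in>pverts G - {u}. coords (p v))"
  have "coords c \<subseteq> euclidean_closure ?U"
    using cS(1) euclidean_closure_mono[of "\<Union>v\<in>S. coords (p v)" ?U] cS(2) by blast
  then have "insert r (coords c) \<subseteq> euclidean_closure ?U"
    by (simp add: euclidean_closure_inc)
  from euclidean_closure_minimal[OF this] r have "coords (p u) \<subseteq> euclidean_closure ?U"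
    by blast
  then show False
    using generic_not_one_parameter[OF gen fw _ fin u] M by (simp add: mirror_surface_def)
qed

text \<open>
  Fewer than \<open>k\<close> points leave a nonzero normal in a \<open>k\<close>-dimensional space: an axis for no point, a
  horizontal vector for one point, the cross product for two points. That these do not degenerate
  follows from genericity itself, by applying \<open>generic_off_mirror\<close> to auxiliary normals whose inner
  product with a point is a component of the vector in question.
\<close>
lemma normal_through_few_points:
  assumes M: "mirror_surface M k" and gen: "generic_framework G p" and fw: "framework_on M G p"
    and fin: "finite (pverts G)" and S: "S \<subseteq> pverts G" "card S < k" and k: "k \<le> 3"
  obtains c where "c \<in> mirror_normals k" "c \<noteq> 0" "\<And>s. s \<in> S \<Longrightarrow> c \<bullet> p s = 0"
    "coords c \<subseteq> euclidean_closure (\<Union>v\<in>S. coords (p v))"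
proof -
  have second: "p s $ 2 \<noteq> 0" if "s \<in> S" "2 \<le> k" for s
  proof -
    let ?c = "vector [0, 1, 0] :: real ^ 3"
    have "?c \<bullet> p s \<noteq> 0"
    proof (rule generic_off_mirror[OF M gen fw fin, where S = "{}"])
      show "coords ?c \<subseteq> euclidean_closure (\<Union>v\<in>{}. coords (p v))"
        by (simp add: coords_def vector_3 euclidean_closure_0 euclidean_closure_1)
    qed (use that S in \<open>auto simp: mirror_normals_def vec3_eq_0_iff vector_3\<close>)
    then show ?thesis by (simp add: inner_3 vector_3)
  qed
  have "finite S" using S fin finite_subset by blast
  consider "card S = 0" | "card S = 1" "2 \<le> k" | "card S = 2" "k = 3"
    using S(2) k by linarith
  then show thesis
  proof cases
    case 1
    then have "S = {}" using \<open>finite S\<close> by simp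
    then show thesis
      by (intro that[of "vector [1, 0, 0]"])
        (auto simp: mirror_normals_def vec3_eq_0_iff vector_3 coords_def
          euclidean_closure_0 euclidean_closure_1)
  next
    case 2
    then obtain s where s: "S = {s}" by (auto simp: card_1_singleton_iff)
    have F: "p s $ 1 \<in> euclidean_closure (coords (p s))" "p s $ 2 \<in> euclidean_closure (coords (p s))"
      by (rule coords_in_closure; blast)+
    show thesis
      using s 2 second[of s] F
      by (intro that[of "vector [p s $ 2, - (p s $ 1), 0]"])
        (auto simp: mirror_normals_def vec3_eq_0_iff vector_3 coords_def inner_3
          euclidean_closure_0 euclidean_closure_uminus)
  next
    case 3
    then obtain s t where st: "S = {s, t}" "s \<noteq> t" by (auto simp: card_2_iff)
    let ?d = "vector [0, - (p s $ 3), p s $ 2] :: real ^ 3"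
    have "?d \<bullet> p t \<noteq> 0"
    proof (rule generic_off_mirror[OF M gen fw fin, where S = "{s}"])
      show "coords ?d \<subseteq> euclidean_closure (\<Union>v\<in>{s}. coords (p v))"
        using coords_in_closure[of "p s" "coords (p s)"]
        by (simp add: coords_def[of ?d] vector_3 euclidean_closure_0 euclidean_closure_uminus)
    qed (use 3 st S second[of s] in \<open>auto simp: mirror_normals_def vec3_eq_0_iff vector_3\<close>)
    then have "cross3 (p s) (p t) $ 1 \<noteq> 0"
      by (simp add: inner_3 cross3_def vector_3 algebra_simps)
    then have "cross3 (p s) (p t) \<noteq> 0" by auto
    moreover have "coords (cross3 (p s) (p t)) \<subseteq> euclidean_closure (\<Union>v\<in>S. coords (p v))"
    proof -
      have "p s $ i \<in> euclidean_closure (\<Union>v\<in>S. coords (p v))"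
        "p t $ i \<in> euclidean_closure (\<Union>v\<in>S. coords (p v))" for i
        using st(1) by (auto simp: coords_conv intro!: euclidean_closure_inc)
      then show ?thesis
        by (intro coords_subsetI)
          (simp_all add: cross3_def vector_3 euclidean_closure_diff euclidean_closure_mult)
    qed
    ultimately show thesis
      using 3 st(1)
      by (intro that[of "cross3 (p s) (p t)"])
        (auto simp: mirror_normals_def dot_cross_self inner_commute)
  qed
qed

theorem proposition8p1:
  fixes M :: "(real ^ 3) set" and a b :: rat and k :: nat
    and G :: "'v pair_pre_digraph" and p :: "'v \<Rightarrow> real ^ 3"
  assumes "1 < a" and "a < b"
    and "(M, k) \<in> {(unit_sphere, 3), (unit_cylinder, 2), (unit_cone, 2), (ellipsoid a b, 1)}"
    and "pair_graph G"
    and "4 \<le> card (pverts G)"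
    and "framework_on M G p"
    and "generic_framework G p"
    and "globally_rigid_on M G p"
  shows "k_connected k G"
proof -
  have "b \<noteq> 0" using assms(1,2) by simp
  then have M: "mirror_surface M k"
    using assms(3) mirror_surface_sphere mirror_surface_cylinder mirror_surface_cone
      mirror_surface_ellipsoid by auto
  have k: "k \<le> 3" using assms(3) by auto
  interpret pair_graph G by fact
  note fin = pair_finite_verts
  show ?thesis
    unfolding k_connected_def
  proof (intro conjI allI impI)
    show "k + 1 \<le> card (pverts G)" using k assms(5) by simp
    fix S assume S: "S \<subseteq> pverts G" "card S < k"
    obtain c where c: "c \<in> mirror_normals k" "c \<noteq> 0" "\<And>s. s \<in> S \<Longrightarrow> c \<bullet> p s = 0"
      and cS: "coords c \<subseteq> euclidean_closure (\<Union>v\<in>S. coords (p v))"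
      using normal_through_few_points[OF M assms(7,6) fin S k] by metis
    have off: "c \<bullet> p v \<noteq> 0" if "v \<in> pverts G - S" for v
      using generic_off_mirror[OF M assms(7,6) fin _ c(1,2) cS] that S(1) by blast
    have "pverts G - S \<noteq> {}"
    proof
      assume "pverts G - S = {}"
      then have "pverts G = S" using S(1) by blast
      then show False using S(2) k assms(5) by simp
    qed
    moreover have "mirror c ` M \<subseteq> M"
      using M c(1) by (simp add: mirror_surface_def)
    ultimately show "Digraph_Component.connected (with_proj G \<restriction> (pverts G - S))"
      using mirror_separator_impossible[OF assms(4,6,8) _ _ c(2) _ c(3) off] by blast
  qed
qed

end
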